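(* Let $\mathcal H$ be a nonzero finite-dimensional complex Hilbert space and let $S$ be the real vector space of Hermitian operators belonging to a $\dagger$-closed complex linear subspace, containing the identity operator, of the space of all linear operators on $\mathcal H$. Let $\omega$ be a state with unit relative purity, i.e. $P_S(\omega)=1$. Then the reduced state $\pi(\omega)$ has a unique preimage (that is, $\omega$ is the only state $\sigma$ with $\pi(\sigma)=\pi(\omega)$), and $\omega$ is generalized unentangled relative to $S$.
   Context: A state $\omega$ is a normalized quantum state on $\mathcal H$, identified with a density operator $\rho_\omega$ (positive semidefinite, trace one) through $\omega(X)=\mathrm{tr}(\rho_\omega X)$ for all Hermitian $X$. Let $\hat C$ denote the convex set of all states. The reduced state $\pi(\omega)$ is the restriction of the linear functional $X\mapsto \mathrm{tr}(\rho_\omega X)$ to $S$, and $\hat D=\{\pi(\omega):\omega\in\hat C\}$ is the convex set of reduced states. The relative purity of $\omega$ is $P_S(\omega)=\sum_\alpha |\mathrm{tr}(\rho_\omega X_\alpha)|^2$, where $(X_\alpha)$ is any basis of $S$ that is orthonormal for the trace inner product $\langle A,B\rangle=\mathrm{tr}(AB)$. Equivalently, $P_S(\omega)=\mathrm{tr}[\Pi_S(\rho_\omega)^2]$, where $\Pi_S$ is the orthogonal projection (with respect to the trace inner product) of the space of Hermitian operators onto $S$. A state is generalized unentangled (relative to $S$) if it lies in the closure of the convex hull of the set of extreme points $x$ of $\hat C$ whose images $\pi(x)$ are extreme points of $\hat D$. *)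

theory Defs
  imports "HOL-Analysis.Analysis" "HOL-Library.Function_Algebras"
begin

text \<open>
  A type of class \<open>euclidean_space\<close> is a nonzero finite-dimensional real inner product space
  (with a chosen real orthonormal basis, which plays no role below).  The class adds a complex
  structure and a complex inner product, linear in its second argument, whose real part is the
  given real inner product.  Norm and topology are then those of the Hilbert space, and positive
  definiteness is inherited from the real inner product.
\<close>

class fd_chilbert = euclidean_space +
  fixes scaleC :: "complex \<Rightarrow> 'a \<Rightarrow> 'a" (infixr "*\<^sub>C" 75)
    and cinner :: "'a \<Rightarrow> 'a \<Rightarrow> complex"
  assumes scaleC_of_real: "complex_of_real r *\<^sub>C x = r *\<^sub>R x"
    and scaleC_add_right: "c *\<^sub>C (x + y) = c *\<^sub>C x + c *\<^sub>C y"
    and scaleC_add_left: "(c + d) *\<^sub>C x = c *\<^sub>C x + d *\<^sub>C x"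
    and scaleC_scaleC: "c *\<^sub>C (d *\<^sub>C x) = (c * d) *\<^sub>C x"
    and cinner_commute: "cinner x y = cnj (cinner y x)"
    and cinner_add_right: "cinner x (y + z) = cinner x y + cinner x z"
    and cinner_scaleC_right: "cinner x (c *\<^sub>C y) = c * cinner x y"
    and Re_cinner: "Re (cinner x y) = inner x y"

instantiation complex :: fd_chilbert
begin

definition scaleC_complex :: "complex \<Rightarrow> complex \<Rightarrow> complex"
  where "scaleC_complex c x = c * x"

definition cinner_complex :: "complex \<Rightarrow> complex \<Rightarrow> complex"
  where "cinner_complex x y = cnj x * y"

instance
  by standard
    (simp_all add: scaleC_complex_def cinner_complex_def scaleR_conv_of_real inner_complex_def
      algebra_simps)

end

instantiation vec :: (fd_chilbert, finite) fd_chilbert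
begin

definition scaleC_vec :: "complex \<Rightarrow> 'a ^ 'b \<Rightarrow> 'a ^ 'b"
  where "scaleC_vec c x = (\<chi> i. c *\<^sub>C (x $ i))"

definition cinner_vec :: "'a ^ 'b \<Rightarrow> 'a ^ 'b \<Rightarrow> complex"
  where "cinner_vec x y = (\<Sum>i\<in>UNIV. cinner (x $ i) (y $ i))"

instance
proof
  fix x y z :: "'a ^ 'b" and c d :: complex and r :: real
  show "complex_of_real r *\<^sub>C x = r *\<^sub>R x"
    by (simp add: scaleC_vec_def vec_eq_iff scaleC_of_real)
  show "c *\<^sub>C (x + y) = c *\<^sub>C x + c *\<^sub>C y"
    by (simp add: scaleC_vec_def vec_eq_iff scaleC_add_right)
  show "(c + d) *\<^sub>C x = c *\<^sub>C x + d *\<^sub>C x"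
    by (simp add: scaleC_vec_def vec_eq_iff scaleC_add_left)
  show "c *\<^sub>C (d *\<^sub>C x) = (c * d) *\<^sub>C x"
    by (simp add: scaleC_vec_def vec_eq_iff scaleC_scaleC)
  show "cinner x y = cnj (cinner y x)"
    unfolding cinner_vec_def cnj_sum by (rule sum.cong[OF refl], rule cinner_commute)
  show "cinner x (y + z) = cinner x y + cinner x z"
    by (simp add: cinner_vec_def cinner_add_right sum.distrib)
  show "cinner x (c *\<^sub>C y) = c * cinner x y"
    by (simp add: cinner_vec_def scaleC_vec_def cinner_scaleC_right sum_distrib_left)
  show "Re (cinner x y) = inner x y"
    by (simp add: cinner_vec_def inner_vec_def Re_cinner)
qed

end

lemma cinner_add_left:
  "cinner (x + y) (z :: 'a::fd_chilbert) = cinner x z + cinner y z"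
  by (metis cinner_commute cinner_add_right complex_cnj_add)

lemma cinner_scaleC_left:
  "cinner (c *\<^sub>C x) (y :: 'a::fd_chilbert) = cnj c * cinner x y"
  by (metis cinner_commute cinner_scaleC_right complex_cnj_mult)

lemma cinner_zero_right [simp]: "cinner x (0 :: 'a::fd_chilbert) = 0"
  using cinner_add_right[of x 0 0] by simp

lemma cinner_zero_left [simp]: "cinner (0 :: 'a::fd_chilbert) x = 0"
  using cinner_add_left[of 0 0 x] by simp

lemma cinner_sum_right:
  "cinner (x :: 'a::fd_chilbert) (\<Sum>i\<in>I. f i) = (\<Sum>i\<in>I. cinner x (f i))"
  by (induction I rule: infinite_finite_induct) (simp_all add: cinner_add_right)

lemma cinner_sum_left:
  "cinner (\<Sum>i\<in>I. f i) (x :: 'a::fd_chilbert) = (\<Sum>i\<in>I. cinner (f i) x)"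
  by (induction I rule: infinite_finite_induct) (simp_all add: cinner_add_left)

lemma cinner_minus_right: "cinner x (- y :: 'a::fd_chilbert) = - cinner x y"
  using cinner_add_right[of x y "- y"] by (simp add: eq_neg_iff_add_eq_0 add.commute)

lemma cinner_diff_right:
  "cinner x (y - z :: 'a::fd_chilbert) = cinner x y - cinner x z"
  using cinner_add_right[of x y "- z"] by (simp add: cinner_minus_right)

lemma cinner_scaleR_right:
  "cinner x (r *\<^sub>R y :: 'a::fd_chilbert) = complex_of_real r * cinner x y"
  by (metis cinner_scaleC_right scaleC_of_real)

lemma cinner_self: "cinner x (x :: 'a::fd_chilbert) = complex_of_real ((norm x)\<^sup>2)"
proof (rule complex_eqI)
  show "Re (cinner x x) = Re (complex_of_real ((norm x)\<^sup>2))"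
    by (simp add: Re_cinner power2_norm_eq_inner)
  have "cinner x x = cnj (cinner x x)" by (rule cinner_commute)
  then show "Im (cinner x x) = Im (complex_of_real ((norm x)\<^sup>2))"
    by (metis Im_complex_of_real Reals_cnj_iff complex_is_Real_iff)
qed

lemma cinner_eqI:
  assumes "\<And>x. cinner x y = cinner x (z :: 'a::fd_chilbert)"
  shows "y = z"
  using assms[of "y - z"] cinner_self[of "y - z"] by (simp add: cinner_diff_right)

lemma Im_cinner: "Im (cinner x (y :: 'a::fd_chilbert)) = inner (\<i> *\<^sub>C x) y"
  by (simp add: Re_cinner[symmetric] cinner_scaleC_left)

lemma cinner_eq_of_inner:
  assumes "\<And>x. inner x y = inner (f x) (z :: 'a::fd_chilbert)"
    and "\<And>x. f (\<i> *\<^sub>C x) = \<i> *\<^sub>C f (x :: 'a)"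
  shows "cinner x y = cinner (f x) z"
  by (rule complex_eqI) (simp_all add: Re_cinner Im_cinner assms(1)[of x] assms(1)[of "\<i> *\<^sub>C x"] assms(2))

lemma norm_scaleC: "norm (c *\<^sub>C (x :: 'a::fd_chilbert)) = cmod c * norm x"
proof -
  have "complex_of_real ((norm (c *\<^sub>C x))\<^sup>2) = complex_of_real ((cmod c * norm x)\<^sup>2)"
  proof -
    have "complex_of_real ((norm (c *\<^sub>C x))\<^sup>2) = (c * cnj c) * cinner x x"
      by (simp only: cinner_self[symmetric] cinner_scaleC_left cinner_scaleC_right mult_ac)
    then show ?thesis
      by (simp only: complex_norm_square[symmetric] cinner_self of_real_mult[symmetric]
          power_mult_distrib)
  qed
  then have "(norm (c *\<^sub>C x))\<^sup>2 = (cmod c * norm x)\<^sup>2"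
    using of_real_eq_iff by blast
  then show ?thesis by (simp add: power2_eq_iff_nonneg)
qed

lemma bounded_linear_scaleC: "bounded_linear (\<lambda>x :: 'a::fd_chilbert. c *\<^sub>C x)"
proof (rule bounded_linear_intro[where K = "cmod c"])
  show "c *\<^sub>C (r *\<^sub>R x) = r *\<^sub>R (c *\<^sub>C x)" for r and x :: 'a
    by (simp add: scaleC_of_real[symmetric] scaleC_scaleC mult.commute)
qed (simp_all add: scaleC_add_right norm_scaleC mult.commute)

text \<open>
  The library type \<open>'a \<Rightarrow>\<^sub>L 'a\<close> consists of all real-linear maps (boundedness being automatic in
  finite dimension), normed by the operator norm.  The linear operators on the Hilbert space are
  its complex-linear elements.
\<close>

definition linear_operators :: "('a::fd_chilbert \<Rightarrow>\<^sub>L 'a) set"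
  where "linear_operators = {A :: 'a \<Rightarrow>\<^sub>L 'a. \<forall>c x. A (c *\<^sub>C x) = c *\<^sub>C A x}"

definition scaleC_op :: "complex \<Rightarrow> ('a::fd_chilbert \<Rightarrow>\<^sub>L 'a) \<Rightarrow> ('a \<Rightarrow>\<^sub>L 'a)"
  where "scaleC_op c A = Blinfun (\<lambda>x. c *\<^sub>C A x)"

lemma scaleC_op_apply: "scaleC_op c A x = c *\<^sub>C A x"
  unfolding scaleC_op_def
  by (subst bounded_linear_Blinfun_apply)
    (rule bounded_linear_compose[OF bounded_linear_scaleC blinfun.bounded_linear_right], rule refl)

definition operator_subspace :: "('a::fd_chilbert \<Rightarrow>\<^sub>L 'a) set \<Rightarrow> bool"
  where "operator_subspace W \<longleftrightarrow>
    W \<subseteq> linear_operators \<and> 0 \<in> W \<and>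
    (\<forall>A\<in>W. \<forall>B\<in>W. A + B \<in> W) \<and> (\<forall>c. \<forall>A\<in>W. scaleC_op c A \<in> W)"

definition cadjoint :: "('a::fd_chilbert \<Rightarrow>\<^sub>L 'a) \<Rightarrow> ('a \<Rightarrow>\<^sub>L 'a)"
  where "cadjoint A = (THE B :: 'a \<Rightarrow>\<^sub>L 'a. \<forall>x y. cinner (B x) y = cinner x (A y))"

lemma cadjoint_unique:
  fixes A B :: "'a::fd_chilbert \<Rightarrow>\<^sub>L 'a"
  assumes "\<And>x y. cinner (B x) y = cinner x (A y)"
  shows "cadjoint A = B"
  unfolding cadjoint_def
proof (rule the_equality)
  fix C assume C: "\<forall>x y. cinner (blinfun_apply C x) y = cinner x (A y)"
  show "C = B"
  proof (rule blinfun_eqI, rule cinner_eqI)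
    fix x z show "cinner z (C x) = cinner z (B x)"
      using C assms by (metis cinner_commute)
  qed
qed (use assms in blast)

lemma cinner_cadjoint:
  fixes A :: "'a::fd_chilbert \<Rightarrow>\<^sub>L 'a"
  assumes "A \<in> linear_operators"
  shows "cinner (cadjoint A x) y = cinner x (A y)"
proof -
  have lin: "linear (blinfun_apply A)"
    by (rule bounded_linear.linear[OF blinfun.bounded_linear_right])
  define B where "B = Blinfun (adjoint (blinfun_apply A))"
  have B: "B x = adjoint (blinfun_apply A) x" for x
    unfolding B_def
    by (subst bounded_linear_Blinfun_apply)
      (simp_all add: linear_conv_bounded_linear[symmetric] adjoint_linear[OF lin])
  have "cinner y (B x) = cinner (A y) x" for x y
  proof (rule cinner_eq_of_inner)
    show "inner z (B x) = inner (A z) x" for z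
      using adjoint_works[OF lin, of z x] by (simp add: B inner_commute)
    show "A (\<i> *\<^sub>C z) = \<i> *\<^sub>C A z" for z
      using assms by (simp add: linear_operators_def)
  qed
  then have eq: "cinner (B x) y = cinner x (A y)" for x y
    by (metis cinner_commute)
  then have "cadjoint A = B" by (rule cadjoint_unique)
  then show ?thesis using eq by simp
qed

definition hermitian :: "('a::fd_chilbert \<Rightarrow>\<^sub>L 'a) \<Rightarrow> bool"
  where "hermitian A \<longleftrightarrow> A \<in> linear_operators \<and> cadjoint A = A"

lemma hermitian_cinner: "hermitian A \<Longrightarrow> cinner (A x) y = cinner x (A y)"
  using cinner_cadjoint[of A x y] by (simp add: hermitian_def)

definition is_onb :: "'a::fd_chilbert set \<Rightarrow> bool"
  where "is_onb E \<longleftrightarrow> finite E \<and>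
    (\<forall>e\<in>E. \<forall>f\<in>E. cinner e f = (if e = f then 1 else 0)) \<and>
    (\<forall>x. \<exists>c. x = (\<Sum>e\<in>E. c e *\<^sub>C e))"

text \<open>The choice of basis is immaterial, by \<open>ex_onb\<close> and \<open>ctrace_onb\<close> below.\<close>

definition ctrace :: "('a::fd_chilbert \<Rightarrow>\<^sub>L 'a) \<Rightarrow> complex"
  where "ctrace A = (\<Sum>e\<in>(SOME E. is_onb E). cinner e (A e))"

lemma ex_onb: "\<exists>E :: 'a::fd_chilbert set. is_onb E"
proof -
  define ons :: "'a set \<Rightarrow> bool" where
    "ons E \<longleftrightarrow> finite E \<and> (\<forall>e\<in>E. \<forall>f\<in>E. cinner e f = (if e = f then 1 else 0))" for E
  have bound: "card E < Suc DIM('a)" if "ons E" for E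
  proof -
    have "pairwise orthogonal E"
      using that by (auto simp: ons_def pairwise_def orthogonal_def Re_cinner[symmetric])
    moreover have "0 \<notin> E"
    proof
      assume "0 \<in> E"
      then have "cinner 0 (0 :: 'a) = 1" using that unfolding ons_def by metis
      then show False by simp
    qed
    ultimately have "independent E" by (rule pairwise_orthogonal_independent)
    then show ?thesis using independent_bound[of E] by (simp add: less_Suc_eq_le)
  qed
  have "ons {}" by (simp add: ons_def)
  from ex_has_greatest_nat[of ons, OF this, of card "Suc DIM('a)"] bound
  obtain E where E: "ons E" and maxi: "\<And>F. ons F \<Longrightarrow> card F \<le> card E"
    by (metis less_imp_le_nat)
  have fin: "finite E" and on: "\<And>e f. e \<in> E \<Longrightarrow> f \<in> E \<Longrightarrow> cinner e f = (if e = f then 1 else 0)"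
    using E by (auto simp: ons_def)
  have "x = (\<Sum>e\<in>E. cinner e x *\<^sub>C e)" for x
  proof (rule ccontr)
    assume neq: "x \<noteq> (\<Sum>e\<in>E. cinner e x *\<^sub>C e)"
    define y where "y = x - (\<Sum>e\<in>E. cinner e x *\<^sub>C e)"
    define z where "z = (1 / norm y) *\<^sub>R y"
    have y0: "y \<noteq> 0" using neq by (simp add: y_def)
    have orth: "cinner f y = 0" if "f \<in> E" for f
    proof -
      have "(\<Sum>e\<in>E. cinner e x * cinner f e) = (\<Sum>e\<in>E. if f = e then cinner e x else 0)"
        by (rule sum.cong) (auto simp: on that)
      then show ?thesis
        using fin that
        by (simp add: y_def cinner_diff_right cinner_sum_right cinner_scaleC_right)
    qed
    have zE: "cinner f z = 0" "cinner z f = 0" if "f \<in> E" for f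
    proof -
      show "cinner f z = 0" by (simp add: z_def cinner_scaleR_right orth[OF that])
      then show "cinner z f = 0" by (subst cinner_commute) simp
    qed
    have zz: "cinner z z = 1" using y0 by (simp add: cinner_self z_def)
    have nin: "z \<notin> E" using zE zz by fastforce
    then have ne: "z \<noteq> f" "f \<noteq> z" if "f \<in> E" for f using that by auto
    have "ons (insert z E)"
      unfolding ons_def using fin by (simp add: zE zz on ne)
    with nin show False using maxi[of "insert z E"] fin by simp
  qed
  then have "\<forall>x. \<exists>c. x = (\<Sum>e\<in>E. c e *\<^sub>C e)"
    by (intro allI, rule_tac x = "\<lambda>e. cinner e x" in exI)
  then have "is_onb E" using E by (simp add: is_onb_def ons_def)
  then show ?thesis ..
qed

lemma onb_expansion:
  assumes "is_onb E"
  shows "x = (\<Sum>e\<in>E. cinner e x *\<^sub>C e)"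
proof -
  obtain c where c: "x = (\<Sum>e\<in>E. c e *\<^sub>C e)" using assms unfolding is_onb_def by blast
  have "cinner f x = c f" if "f \<in> E" for f
  proof -
    have "cinner f x = (\<Sum>e\<in>E. c e * cinner f e)"
      by (subst c) (simp add: cinner_sum_right cinner_scaleC_right)
    also have "\<dots> = (\<Sum>e\<in>E. if f = e then c e else 0)"
      by (rule sum.cong) (use assms that in \<open>auto simp: is_onb_def\<close>)
    finally show ?thesis using assms that by (simp add: is_onb_def)
  qed
  then show ?thesis using c by simp
qed

lemma onb_parseval:
  assumes "is_onb E"
  shows "cinner x y = (\<Sum>e\<in>E. cinner x e * cinner e y)"
  by (subst onb_expansion[OF assms, of y])
    (simp add: cinner_sum_right cinner_scaleC_right mult.commute)

lemma onb_trace_comp: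
  fixes A B :: "'a::fd_chilbert \<Rightarrow> 'a"
  assumes E: "is_onb E" and F: "is_onb F"
    and A: "\<And>x y. cinner (A' x) y = cinner x (A y)"
  shows "(\<Sum>e\<in>E. cinner e (A (B e))) = (\<Sum>e\<in>E. \<Sum>f\<in>F. cinner e (A f) * cinner f (B e))"
proof (rule sum.cong[OF refl])
  fix e
  show "cinner e (A (B e)) = (\<Sum>f\<in>F. cinner e (A f) * cinner f (B e))"
    by (simp add: A[symmetric] onb_parseval[OF F, of "A' e" "B e"])
qed

lemma ctrace_onb:
  fixes A :: "'a::fd_chilbert \<Rightarrow>\<^sub>L 'a"
  assumes E: "is_onb E" and A: "A \<in> linear_operators"
  shows "ctrace A = (\<Sum>e\<in>E. cinner e (A e))"
proof -
  define F :: "'a set" where "F = (SOME F. is_onb F)"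
  have F: "is_onb F" unfolding F_def by (rule someI_ex[OF ex_onb])
  have "ctrace A = (\<Sum>f\<in>F. cinner f (A f))" by (simp add: ctrace_def F_def)
  also have "\<dots> = (\<Sum>f\<in>F. \<Sum>e\<in>E. cinner f (A e) * cinner e f)"
    using onb_trace_comp[of F E "cadjoint A" A "\<lambda>x. x"] E F cinner_cadjoint[OF A] by simp
  also have "\<dots> = (\<Sum>e\<in>E. \<Sum>f\<in>F. cinner e f * cinner f (A e))"
    by (subst sum.swap) (simp add: mult.commute)
  also have "\<dots> = (\<Sum>e\<in>E. cinner e (A e))"
    by (simp add: onb_parseval[OF F, symmetric])
  finally show ?thesis .
qed

text \<open>States are represented by their density operators.\<close>

definition states :: "('a::fd_chilbert \<Rightarrow>\<^sub>L 'a) set"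
  where "states = {\<rho> :: 'a \<Rightarrow>\<^sub>L 'a. hermitian \<rho> \<and> (\<forall>x. 0 \<le> Re (cinner x (\<rho> x))) \<and> ctrace \<rho> = 1}"

text \<open>
  The library's extreme points require a real vector space, so functions get their pointwise
  real vector space structure.
\<close>

instantiation "fun" :: (type, real_vector) real_vector
begin

definition scaleR_fun :: "real \<Rightarrow> ('a \<Rightarrow> 'b) \<Rightarrow> 'a \<Rightarrow> 'b"
  where "scaleR_fun r f = (\<lambda>x. r *\<^sub>R f x)"

instance
  by standard
    (simp_all add: scaleR_fun_def fun_eq_iff scaleR_add_right scaleR_add_left)

end

text \<open>
  A functional on \<open>S\<close> is represented by its extension by \<open>0\<close> outside \<open>S\<close>; the pointwise vector
  space operations then restrict to those of functionals on \<open>S\<close>.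
\<close>

definition reduced_state ::
    "('a::fd_chilbert \<Rightarrow>\<^sub>L 'a) set \<Rightarrow> ('a \<Rightarrow>\<^sub>L 'a) \<Rightarrow> (('a \<Rightarrow>\<^sub>L 'a) \<Rightarrow> complex)"
  where "reduced_state S \<rho> = (\<lambda>X. if X \<in> S then ctrace (\<rho> o\<^sub>L X) else 0)"

definition reduced_states :: "('a::fd_chilbert \<Rightarrow>\<^sub>L 'a) set \<Rightarrow> (('a \<Rightarrow>\<^sub>L 'a) \<Rightarrow> complex) set"
  where "reduced_states S = reduced_state S ` states"

definition is_trace_onb :: "('a::fd_chilbert \<Rightarrow>\<^sub>L 'a) set \<Rightarrow> ('a \<Rightarrow>\<^sub>L 'a) set \<Rightarrow> bool"
  where "is_trace_onb S B \<longleftrightarrow> finite B \<and> span B = S \<and>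
    (\<forall>X\<in>B. \<forall>Y\<in>B. ctrace (X o\<^sub>L Y) = (if X = Y then 1 else 0))"

text \<open>
  The choice of basis is immaterial, by \<open>ex_trace_onb\<close> and \<open>relative_purity_eq\<close> below.
\<close>

definition relative_purity :: "('a::fd_chilbert \<Rightarrow>\<^sub>L 'a) set \<Rightarrow> ('a \<Rightarrow>\<^sub>L 'a) \<Rightarrow> real"
  where "relative_purity S \<rho> =
    (\<Sum>X\<in>(SOME B. is_trace_onb S B). (cmod (ctrace (\<rho> o\<^sub>L X)))\<^sup>2)"

lemma linear_operators_add:
  "A \<in> linear_operators \<Longrightarrow> B \<in> linear_operators \<Longrightarrow> A + B \<in> linear_operators"
  by (simp add: linear_operators_def blinfun.add_left scaleC_add_right)

lemma linear_operators_scaleR: "A \<in> linear_operators \<Longrightarrow> r *\<^sub>R A \<in> linear_operators"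
  by (simp add: linear_operators_def blinfun.scaleR_left scaleC_of_real[symmetric] scaleC_scaleC
      mult.commute)

lemma linear_operators_comp:
  "A \<in> linear_operators \<Longrightarrow> B \<in> linear_operators \<Longrightarrow> A o\<^sub>L B \<in> linear_operators"
  by (simp add: linear_operators_def)

lemma scaleC_zero [simp]: "c *\<^sub>C (0 :: 'a::fd_chilbert) = 0"
  using scaleC_add_right[of c 0 "0 :: 'a"] by simp

lemma hermitian_zero: "hermitian 0"
  unfolding hermitian_def
  by (auto simp: linear_operators_def blinfun.zero_left intro!: cadjoint_unique)

lemma hermitian_add: "hermitian A \<Longrightarrow> hermitian B \<Longrightarrow> hermitian (A + B)"
  unfolding hermitian_def[of "A + B"]
  by (auto simp: blinfun.add_left cinner_add_left cinner_add_right hermitian_cinner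
      hermitian_def[THEN iffD1, THEN conjunct1] intro!: linear_operators_add cadjoint_unique)

lemma cinner_scaleR_left:
  "cinner (r *\<^sub>R x) (y :: 'a::fd_chilbert) = complex_of_real r * cinner x y"
  by (metis cinner_scaleC_left scaleC_of_real complex_cnj_complex_of_real)

lemma hermitian_scaleR: "hermitian A \<Longrightarrow> hermitian (r *\<^sub>R A)"
  unfolding hermitian_def[of "r *\<^sub>R A"]
  by (auto simp: blinfun.scaleR_left cinner_scaleR_left cinner_scaleR_right hermitian_cinner
      hermitian_def[THEN iffD1, THEN conjunct1] intro!: linear_operators_scaleR cadjoint_unique)

lemma subspace_hermitian: "subspace (Collect hermitian)"
  by (auto simp: subspace_def hermitian_zero hermitian_add hermitian_scaleR)

lemma subspace_hermitian_part:
  assumes "operator_subspace W"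
  shows "subspace {A \<in> W. hermitian A}"
proof -
  have "r *\<^sub>R A = scaleC_op (complex_of_real r) A" for r and A :: "'a \<Rightarrow>\<^sub>L 'a"
    by (rule blinfun_eqI) (simp add: scaleC_op_apply scaleC_of_real blinfun.scaleR_left)
  then have "subspace W"
    using assms by (auto simp: subspace_def operator_subspace_def)
  then have "subspace (W \<inter> Collect hermitian)"
    by (intro subspace_inter subspace_hermitian)
  then show ?thesis by (simp add: Int_def)
qed

lemma hermitian_linear: "hermitian A \<Longrightarrow> A \<in> linear_operators"
  by (simp add: hermitian_def)

lemma ctrace_comp_commute:
  fixes A B :: "'a::fd_chilbert \<Rightarrow>\<^sub>L 'a"
  assumes A: "A \<in> linear_operators" and B: "B \<in> linear_operators"
  shows "ctrace (A o\<^sub>L B) = ctrace (B o\<^sub>L A)"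
proof -
  obtain E :: "'a set" where E: "is_onb E" using ex_onb by blast
  have "ctrace (A o\<^sub>L B) = (\<Sum>e\<in>E. \<Sum>f\<in>E. cinner e (A f) * cinner f (B e))"
    using onb_trace_comp[of E E "cadjoint A" A B] E cinner_cadjoint[OF A]
    by (simp add: ctrace_onb[OF E linear_operators_comp[OF A B]])
  also have "\<dots> = (\<Sum>f\<in>E. \<Sum>e\<in>E. cinner f (B e) * cinner e (A f))"
    by (subst sum.swap) (simp add: mult.commute)
  also have "\<dots> = ctrace (B o\<^sub>L A)"
    using onb_trace_comp[of E E "cadjoint B" B A] E cinner_cadjoint[OF B]
    by (simp add: ctrace_onb[OF E linear_operators_comp[OF B A]])
  finally show ?thesis .
qed

lemma ctrace_comp_hermitian_real:
  fixes A B :: "'a::fd_chilbert \<Rightarrow>\<^sub>L 'a"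
  assumes A: "hermitian A" and B: "hermitian B"
  shows "cnj (ctrace (A o\<^sub>L B)) = ctrace (A o\<^sub>L B)"
proof -
  obtain E :: "'a set" where E: "is_onb E" using ex_onb by blast
  note lin = hermitian_linear[OF A] hermitian_linear[OF B]
  have "cnj (ctrace (A o\<^sub>L B)) = (\<Sum>e\<in>E. cinner (A (B e)) e)"
    by (simp add: ctrace_onb[OF E linear_operators_comp[OF lin]] cinner_commute[symmetric])
  also have "\<dots> = (\<Sum>e\<in>E. cinner e (B (A e)))"
    by (simp add: hermitian_cinner[OF A] hermitian_cinner[OF B])
  also have "\<dots> = ctrace (B o\<^sub>L A)"
    by (simp add: ctrace_onb[OF E linear_operators_comp[OF lin(2,1)]])
  finally show ?thesis by (simp add: ctrace_comp_commute[OF lin])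
qed

lemma ctrace_hermitian_square:
  fixes A :: "'a::fd_chilbert \<Rightarrow>\<^sub>L 'a"
  assumes A: "hermitian A" and "A \<noteq> 0"
  shows "0 < Re (ctrace (A o\<^sub>L A))"
proof -
  obtain E :: "'a set" where E: "is_onb E" using ex_onb by blast
  note lin = hermitian_linear[OF A]
  have eq: "Re (ctrace (A o\<^sub>L A)) = (\<Sum>e\<in>E. (norm (A e))\<^sup>2)"
    by (simp add: ctrace_onb[OF E linear_operators_comp[OF lin lin]]
        hermitian_cinner[OF A, symmetric] cinner_self)
  have "\<exists>e\<in>E. A e \<noteq> 0"
  proof (rule ccontr)
    assume *: "\<not> (\<exists>e\<in>E. A e \<noteq> 0)"
    have "A x = 0" for x
    proof -
      have "A x = (\<Sum>e\<in>E. cinner e x *\<^sub>C A e)"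
        using lin by (subst onb_expansion[OF E, of x])
          (simp add: blinfun.sum_right linear_operators_def)
      then show ?thesis using * by simp
    qed
    then have "A = 0" by (intro blinfun_eqI) (simp add: blinfun.zero_left)
    with \<open>A \<noteq> 0\<close> show False by simp
  qed
  then obtain e where "e \<in> E" "A e \<noteq> 0" by blast
  moreover have "finite E" using E by (simp add: is_onb_def)
  ultimately show ?thesis unfolding eq by (intro sum_pos2[of E e]) auto
qed

lemma ctrace_comp_sum_right:
  "ctrace (A o\<^sub>L (\<Sum>i\<in>I. r i *\<^sub>R X i)) = (\<Sum>i\<in>I. complex_of_real (r i) * ctrace (A o\<^sub>L X i))"
  unfolding ctrace_def
  by (simp add: blinfun.sum_left blinfun.sum_right blinfun.scaleR_left blinfun.scaleR_right
      cinner_sum_right cinner_scaleR_right sum_distrib_left) (rule sum.swap)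

lemma trace_onb_expansion:
  fixes S :: "('a::fd_chilbert \<Rightarrow>\<^sub>L 'a) set"
  assumes B: "is_trace_onb S B" and "X \<in> S" "\<And>A. A \<in> S \<Longrightarrow> hermitian A"
  shows "X = (\<Sum>Y\<in>B. Re (ctrace (Y o\<^sub>L X)) *\<^sub>R Y)"
proof -
  have fin: "finite B" and on: "\<And>X Y. X \<in> B \<Longrightarrow> Y \<in> B \<Longrightarrow> ctrace (X o\<^sub>L Y) = (if X = Y then 1 else 0)"
    using B by (auto simp: is_trace_onb_def)
  have "X \<in> span B" using assms by (simp add: is_trace_onb_def)
  then obtain r where r: "X = (\<Sum>Y\<in>B. r Y *\<^sub>R Y)"
    using span_finite[OF fin] by auto
  have "Re (ctrace (Y o\<^sub>L X)) = r Y" if "Y \<in> B" for Y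
  proof -
    have "ctrace (Y o\<^sub>L X) = (\<Sum>Z\<in>B. complex_of_real (r Z) * ctrace (Y o\<^sub>L Z))"
      by (subst r) (rule ctrace_comp_sum_right)
    also have "\<dots> = (\<Sum>Z\<in>B. if Y = Z then complex_of_real (r Z) else 0)"
      by (rule sum.cong) (auto simp: on that)
    finally show ?thesis using fin that by simp
  qed
  then show ?thesis using r by simp
qed

lemma ex_trace_onb:
  fixes S :: "('a::fd_chilbert \<Rightarrow>\<^sub>L 'a) set"
  assumes S: "subspace S" and herm: "\<And>A. A \<in> S \<Longrightarrow> hermitian A"
  shows "\<exists>B. is_trace_onb S B"
proof -
  define ons :: "('a \<Rightarrow>\<^sub>L 'a) set \<Rightarrow> bool" where
    "ons B \<longleftrightarrow> finite B \<and> B \<subseteq> S \<and>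
      (\<forall>X\<in>B. \<forall>Y\<in>B. ctrace (X o\<^sub>L Y) = (if X = Y then 1 else 0))" for B
  define M :: "('a \<Rightarrow>\<^sub>L 'a) set" where
    "M = (\<lambda>(i, j). blinfun_of_matrix (\<lambda>k l. if k = i \<and> l = j then 1 else 0)) ` (Basis \<times> Basis)"
  have finM: "finite M" by (simp add: M_def)
  have spanM: "A \<in> span M" for A :: "'a \<Rightarrow>\<^sub>L 'a"
  proof -
    have "A = (\<Sum>i\<in>Basis. \<Sum>j\<in>Basis. (A j \<bullet> i) *\<^sub>R
        blinfun_of_matrix (\<lambda>k l. if k = i \<and> l = j then 1 else 0))" (is "A = ?R")
    proof (rule blinfun_eqI)
      fix x
      have "?R x = (\<Sum>i\<in>Basis. \<Sum>j\<in>Basis. (A j \<bullet> i) *\<^sub>R ((x \<bullet> j) *\<^sub>R i))"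
      proof -
        have "blinfun_of_matrix (\<lambda>k l. if k = i \<and> l = j then 1 else 0) x = (x \<bullet> j) *\<^sub>R i"
          if "i \<in> Basis" "j \<in> Basis" for i j :: 'a
        proof -
          have "(\<Sum>k\<in>Basis. \<Sum>l\<in>Basis. ((x \<bullet> l) * (if k = i \<and> l = j then 1 else 0)) *\<^sub>R k) =
            (\<Sum>k\<in>Basis. if k = i then (\<Sum>l\<in>Basis. if l = j then (x \<bullet> l) *\<^sub>R k else 0) else 0)"
          proof (rule sum.cong[OF refl])
            fix k
            show "(\<Sum>l\<in>Basis. ((x \<bullet> l) * (if k = i \<and> l = j then 1 else 0)) *\<^sub>R k) =
              (if k = i then (\<Sum>l\<in>Basis. if l = j then (x \<bullet> l) *\<^sub>R k else 0) else 0)"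
            proof (cases "k = i")
              case True
              have "(\<Sum>l\<in>Basis. ((x \<bullet> l) * (if k = i \<and> l = j then 1 else 0)) *\<^sub>R k) =
                (\<Sum>l\<in>Basis. if l = j then (x \<bullet> l) *\<^sub>R k else 0)"
                by (rule sum.cong) (simp_all add: True)
              with True show ?thesis by simp
            qed simp
          qed
          also have "\<dots> = (x \<bullet> j) *\<^sub>R i" using that by (simp add: sum.delta)
          finally show ?thesis by (simp add: blinfun_of_matrix_apply)
        qed
        then show ?thesis by (simp add: blinfun.sum_left blinfun.scaleR_left)
      qed
      also have "\<dots> = blinfun_of_matrix (\<lambda>i j. A j \<bullet> i) x"
        by (simp add: blinfun_of_matrix_apply mult.commute)
      finally show "A x = ?R x" by (simp add: blinfun_of_matrix_works)
    qed
    also have "\<dots> \<in> span M"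
      by (intro span_sum span_scale span_base) (auto simp: M_def)
    finally show ?thesis .
  qed
  have bound: "card B < Suc (card M)" if "ons B" for B
  proof -
    have fin: "finite B" using that by (simp add: ons_def)
    have "independent B"
    proof (rule independent_if_scalars_zero[OF fin])
      fix f X assume 0: "(\<Sum>Y\<in>B. f Y *\<^sub>R Y) = 0" and X: "X \<in> B"
      have "0 = ctrace (X o\<^sub>L (\<Sum>Y\<in>B. f Y *\<^sub>R Y))" by (simp add: 0 ctrace_def)
      also have "\<dots> = (\<Sum>Y\<in>B. if X = Y then complex_of_real (f Y) else 0)"
        unfolding ctrace_comp_sum_right
        by (rule sum.cong) (use that X in \<open>auto simp: ons_def\<close>)
      finally show "f X = 0" using X fin by simp
    qed
    then show ?thesis
      using independent_span_bound[OF finM, of B] spanM by (auto simp: less_Suc_eq_le)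
  qed
  have "ons {}" by (simp add: ons_def)
  from ex_has_greatest_nat[of ons, OF this, of card "Suc (card M)"] bound
  obtain B where B: "ons B" and maxi: "\<And>F. ons F \<Longrightarrow> card F \<le> card B"
    by (metis less_imp_le_nat)
  have fin: "finite B" and BS: "B \<subseteq> S"
    and on: "\<And>X Y. X \<in> B \<Longrightarrow> Y \<in> B \<Longrightarrow> ctrace (X o\<^sub>L Y) = (if X = Y then 1 else 0)"
    using B by (auto simp: ons_def)
  have "X \<in> span B" if "X \<in> S" for X
  proof (rule ccontr)
    assume nX: "X \<notin> span B"
    define P where "P = (\<Sum>Z\<in>B. Re (ctrace (Z o\<^sub>L X)) *\<^sub>R Z)"
    define Y where "Y = X - P"
    define n where "n = sqrt (Re (ctrace (Y o\<^sub>L Y)))"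
    define U where "U = (1 / n) *\<^sub>R Y"
    have "P \<in> span B" unfolding P_def by (intro span_sum span_scale span_base)
    then have Y0: "Y \<noteq> 0" using nX by (auto simp: Y_def)
    have "P \<in> S" unfolding P_def
      by (intro subspace_sum[OF S] subspace_scale[OF S]) (use BS in auto)
    then have YS: "Y \<in> S" unfolding Y_def using that S by (intro subspace_diff) auto
    have real: "complex_of_real (Re (ctrace (A o\<^sub>L C))) = ctrace (A o\<^sub>L C)"
      if "A \<in> S" "C \<in> S" for A C
      using ctrace_comp_hermitian_real[OF herm herm, OF that]
      by (metis Reals_cnj_iff of_real_Re)
    have orth: "ctrace (Z o\<^sub>L Y) = 0" if "Z \<in> B" for Z
    proof -
      have "ctrace (Z o\<^sub>L P) = (\<Sum>V\<in>B. complex_of_real (Re (ctrace (V o\<^sub>L X))) * ctrace (Z o\<^sub>L V))"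
        unfolding P_def by (rule ctrace_comp_sum_right)
      also have "\<dots> = (\<Sum>V\<in>B. if Z = V then complex_of_real (Re (ctrace (V o\<^sub>L X))) else 0)"
        by (rule sum.cong) (auto simp: on that)
      also have "\<dots> = ctrace (Z o\<^sub>L X)" using fin that BS real[of Z X] \<open>X \<in> S\<close> by auto
      finally have "ctrace (Z o\<^sub>L P) = ctrace (Z o\<^sub>L X)" .
      moreover have "ctrace (Z o\<^sub>L X) = ctrace (Z o\<^sub>L Y) + ctrace (Z o\<^sub>L P)"
        by (simp add: ctrace_def Y_def blinfun.diff_left blinfun.diff_right cinner_diff_right
            sum_subtractf)
      ultimately show ?thesis by simp
    qed
    have npos: "n > 0" using ctrace_hermitian_square[OF herm[OF YS] Y0] by (simp add: n_def)
    have US: "U \<in> S" unfolding U_def using YS S by (intro subspace_scale)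
    have scale: "ctrace (A o\<^sub>L U) = complex_of_real (1 / n) * ctrace (A o\<^sub>L Y)" for A
      unfolding U_def using ctrace_comp_sum_right[of A "\<lambda>_. 1 / n" "\<lambda>_. Y" "{()}"] by simp
    have ZU: "ctrace (Z o\<^sub>L U) = 0" "ctrace (U o\<^sub>L Z) = 0" if "Z \<in> B" for Z
    proof -
      show "ctrace (Z o\<^sub>L U) = 0" by (simp add: scale orth[OF that])
      then show "ctrace (U o\<^sub>L Z) = 0"
        using ctrace_comp_commute[of U Z] hermitian_linear herm US BS that by auto
    qed
    have "ctrace (U o\<^sub>L U) = complex_of_real (1 / n) * ctrace (Y o\<^sub>L U)"
      using scale[of U] ctrace_comp_commute[of U Y] hermitian_linear herm US YS by auto
    also have "\<dots> = complex_of_real (1 / n * (1 / n) * Re (ctrace (Y o\<^sub>L Y)))"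
      by (simp add: scale real[OF YS YS])
    also have "Re (ctrace (Y o\<^sub>L Y)) = n\<^sup>2" using npos by (simp add: n_def)
    also have "1 / n * (1 / n) * n\<^sup>2 = 1" using npos by (simp add: power2_eq_square)
    finally have UU: "ctrace (U o\<^sub>L U) = 1" by simp
    have nin: "U \<notin> B" using ZU UU by fastforce
    then have ne: "U \<noteq> Z" "Z \<noteq> U" if "Z \<in> B" for Z using that by auto
    have "ons (insert U B)" unfolding ons_def using fin BS US by (simp add: ZU UU on ne)
    with nin show False using maxi[of "insert U B"] fin by simp
  qed
  moreover have "span B \<subseteq> S" using span_minimal[OF BS S] .
  ultimately have "span B = S" by blast
  then have "is_trace_onb S B" using B by (simp add: ons_def is_trace_onb_def)
  then show ?thesis ..
qed

lemma relative_purity_eq: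
  fixes S :: "('a::fd_chilbert \<Rightarrow>\<^sub>L 'a) set"
  assumes herm: "\<And>A. A \<in> S \<Longrightarrow> hermitian A"
    and B: "is_trace_onb S B" and \<rho>: "hermitian \<rho>"
  shows "relative_purity S \<rho> = (\<Sum>X\<in>B. (cmod (ctrace (\<rho> o\<^sub>L X)))\<^sup>2)"
proof -
  define C where "C = (SOME B. is_trace_onb S B)"
  have C: "is_trace_onb S C" unfolding C_def using B by (rule someI)
  define t where "t X Y = Re (ctrace (X o\<^sub>L Y))" for X Y :: "'a \<Rightarrow>\<^sub>L 'a"
  have sub: "B \<subseteq> S" "C \<subseteq> S"
    using span_superset[of B] span_superset[of C] B C unfolding is_trace_onb_def by simp_all
  have cmod: "(cmod (ctrace (\<rho> o\<^sub>L X)))\<^sup>2 = (t \<rho> X)\<^sup>2" if "X \<in> S" for X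
  proof -
    have "ctrace (\<rho> o\<^sub>L X) = complex_of_real (t \<rho> X)"
      unfolding t_def using ctrace_comp_hermitian_real[OF \<rho> herm[OF that]]
      by (metis Reals_cnj_iff of_real_Re)
    then show ?thesis by simp
  qed
  have expand: "t \<rho> X = (\<Sum>Y\<in>D. t Y X * t \<rho> Y)" if "is_trace_onb S D" "X \<in> S" for D X
  proof -
    have "ctrace (\<rho> o\<^sub>L X) = (\<Sum>Y\<in>D. complex_of_real (t Y X) * ctrace (\<rho> o\<^sub>L Y))"
      unfolding t_def
      by (subst trace_onb_expansion[OF that herm]) (simp_all add: ctrace_comp_sum_right)
    then show ?thesis by (simp add: t_def)
  qed
  have comm: "t X Y = t Y X" if "X \<in> S" "Y \<in> S" for X Y
    unfolding t_def
    using ctrace_comp_commute[OF hermitian_linear hermitian_linear, OF herm herm, OF that] by simp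
  have "(\<Sum>X\<in>B. (t \<rho> X)\<^sup>2) = (\<Sum>X\<in>B. \<Sum>Y\<in>C. t Y X * t \<rho> Y * t \<rho> X)"
  proof (rule sum.cong[OF refl])
    fix X assume "X \<in> B"
    then have "(t \<rho> X)\<^sup>2 = (\<Sum>Y\<in>C. t Y X * t \<rho> Y) * t \<rho> X"
      using expand[OF C, of X] sub by (auto simp: power2_eq_square)
    then show "(t \<rho> X)\<^sup>2 = (\<Sum>Y\<in>C. t Y X * t \<rho> Y * t \<rho> X)" by (simp add: sum_distrib_right)
  qed
  also have "\<dots> = (\<Sum>Y\<in>C. \<Sum>X\<in>B. t Y X * t \<rho> Y * t \<rho> X)" by (rule sum.swap)
  also have "\<dots> = (\<Sum>Y\<in>C. (t \<rho> Y)\<^sup>2)"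
  proof (rule sum.cong[OF refl])
    fix Y assume Y: "Y \<in> C"
    have "(\<Sum>X\<in>B. t Y X * t \<rho> Y * t \<rho> X) = (\<Sum>X\<in>B. t X Y * t \<rho> X) * t \<rho> Y"
      unfolding sum_distrib_right
    proof (rule sum.cong[OF refl])
      fix X assume "X \<in> B"
      then have "t Y X = t X Y" using comm Y sub by blast
      then show "t Y X * t \<rho> Y * t \<rho> X = t X Y * t \<rho> X * t \<rho> Y" by simp
    qed
    also have "\<dots> = (t \<rho> Y)\<^sup>2" using expand[OF B, of Y] Y sub by (auto simp: power2_eq_square)
    finally show "(\<Sum>X\<in>B. t Y X * t \<rho> Y * t \<rho> X) = (t \<rho> Y)\<^sup>2" .
  qed
  finally have "(\<Sum>X\<in>B. (t \<rho> X)\<^sup>2) = (\<Sum>X\<in>C. (t \<rho> X)\<^sup>2)" .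
  moreover have "(\<Sum>X\<in>D. (cmod (ctrace (\<rho> o\<^sub>L X)))\<^sup>2) = (\<Sum>X\<in>D. (t \<rho> X)\<^sup>2)" if "D \<subseteq> S" for D
    by (rule sum.cong[OF refl]) (use cmod that in blast)
  ultimately show ?thesis using sub by (simp add: relative_purity_def C_def[symmetric])
qed

definition generalized_unentangled :: "('a::fd_chilbert \<Rightarrow>\<^sub>L 'a) set \<Rightarrow> ('a \<Rightarrow>\<^sub>L 'a) \<Rightarrow> bool"
  where "generalized_unentangled S \<omega> \<longleftrightarrow>
    \<omega> \<in> closure (convex hull
      {x. x extreme_point_of states \<and> reduced_state S x extreme_point_of reduced_states S})"

end

(*
  A density operator rho satisfies tr(rho^2) <= 1, so tr(rho sigma) <= 1 for states rho and sigma,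
  with equality only if rho = sigma, because 0 <= tr((rho - sigma)^2).  If the relative purity of
  omega is 1, then by Pythagoras omega equals its projection onto S, i.e. omega lies in S.  Hence
  pi(sigma) determines tr(sigma omega), a linear functional whose maximum over the states is
  attained only at omega: this makes omega the only preimage of pi(omega), and makes both omega
  and pi(omega) extreme.
*)
theory Submission
  imports Defs
begin

text \<open>The form given by \<open>\<rho>\<close> may be degenerate. Its nonnegativity at
  \<open>x + c *\<^sub>C y\<close> yields a real quadratic in \<open>s\<close>, and a suitable value
  of \<open>s\<close> gives the bound.\<close>

lemma cinner_positive_cauchy_schwarz:
  fixes \<rho> :: "'a::fd_chilbert \<Rightarrow>\<^sub>L 'a"
  assumes herm: "hermitian \<rho>" and pos: "\<And>x. 0 \<le> Re (cinner x (\<rho> x))"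
  shows "(cmod (cinner x (\<rho> y)))\<^sup>2 \<le> Re (cinner x (\<rho> x)) * Re (cinner y (\<rho> y))"
proof -
  define a b z w where "a = Re (cinner x (\<rho> x))" and "b = Re (cinner y (\<rho> y))"
    and "z = cinner x (\<rho> y)" and "w = (cmod z)\<^sup>2"
  have z': "cinner y (\<rho> x) = cnj z"
    unfolding z_def using hermitian_cinner[OF herm] by (metis cinner_commute)
  have w: "z * cnj z = complex_of_real w"
    unfolding w_def by (rule complex_norm_square[symmetric])
  have quad: "0 \<le> a - 2 * s * w + s\<^sup>2 * w * b" for s
  proof -
    \<comment> \<open>The factor \<open>cnj z\<close> aligns the phases, so that both cross terms
      become the real number \<open>- s * w\<close>.\<close>
    define c where "c = - complex_of_real s * cnj z"
    have cz: "c * z = complex_of_real (- s * w)" "cnj c * cnj z = complex_of_real (- s * w)"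
      using w by (simp_all add: c_def mult_ac)
    have cc: "cnj c * c = complex_of_real (s\<^sup>2 * w)"
      using w by (simp add: c_def power2_eq_square mult_ac)
    have "cinner (x + c *\<^sub>C y) (\<rho> (x + c *\<^sub>C y)) =
      cinner x (\<rho> x) + c * z + cnj c * cnj z + (cnj c * c) * cinner y (\<rho> y)"
      using hermitian_linear[OF herm]
      by (simp add: blinfun.add_right linear_operators_def cinner_add_left cinner_add_right
          cinner_scaleC_left cinner_scaleC_right z' z_def[symmetric] algebra_simps)
    then have "Re (cinner (x + c *\<^sub>C y) (\<rho> (x + c *\<^sub>C y))) = a - 2 * s * w + s\<^sup>2 * w * b"
      unfolding cz cc by (simp add: a_def b_def)
    then show ?thesis using pos[of "x + c *\<^sub>C y"] by simp
  qed
  have a: "0 \<le> a" and b: "0 \<le> b" and w0: "0 \<le> w"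
    using pos by (simp_all add: a_def b_def w_def)
  have "w \<le> a * b"
  proof (cases "b = 0")
    case True
    have "w = 0"
    proof (rule ccontr)
      assume "w \<noteq> 0"
      \<comment> \<open>With \<open>b = 0\<close> the quadratic is affine in \<open>s\<close>; this
        choice of \<open>s\<close> gives it the value -1.\<close>
      then show False using quad[of "(a + 1) / (2 * w)"] True a w0 by simp
    qed
    then show ?thesis by (simp add: True)
  next
    case False
    then have "0 \<le> a - w / b"
      \<comment> \<open>For \<open>w > 0\<close> this is the minimiser of the quadratic.\<close>
      using quad[of "1 / b"] by (simp add: power2_eq_square field_simps)
    then show ?thesis using False b by (simp add: field_simps)
  qed
  then show ?thesis by (simp add: a_def b_def w_def z_def)
qed

text \<open>The trace inner product as a real number: for Hermitian arguments the trace is already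
  real, so \<open>Re\<close> discards nothing.\<close>

definition hs_inner :: "('a::fd_chilbert \<Rightarrow>\<^sub>L 'a) \<Rightarrow> ('a \<Rightarrow>\<^sub>L 'a) \<Rightarrow> real"
  where "hs_inner A B = Re (ctrace (A o\<^sub>L B))"

lemma hs_inner_add_left: "hs_inner (A + B) C = hs_inner A C + hs_inner B C"
  by (simp add: hs_inner_def ctrace_def blinfun.add_left cinner_add_right sum.distrib)

lemma hs_inner_diff_left: "hs_inner (A - B) C = hs_inner A C - hs_inner B C"
  by (simp add: hs_inner_def ctrace_def blinfun.diff_left cinner_diff_right sum_subtractf)

lemma hs_inner_diff_right: "hs_inner A (B - C) = hs_inner A B - hs_inner A C"
  by (simp add: hs_inner_def ctrace_def blinfun.diff_left blinfun.diff_right cinner_diff_right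
      sum_subtractf)

lemma hs_inner_scaleR_left: "hs_inner (r *\<^sub>R A) B = r * hs_inner A B"
  by (simp add: hs_inner_def ctrace_def blinfun.scaleR_left cinner_scaleR_right sum_distrib_left)

lemma hs_inner_sum_right: "hs_inner A (\<Sum>i\<in>I. r i *\<^sub>R X i) = (\<Sum>i\<in>I. r i * hs_inner A (X i))"
  by (simp add: hs_inner_def ctrace_comp_sum_right)

lemma hs_inner_commute: "hermitian A \<Longrightarrow> hermitian B \<Longrightarrow> hs_inner A B = hs_inner B A"
  by (simp add: hs_inner_def ctrace_comp_commute hermitian_linear)

lemma ctrace_comp_eq_hs_inner:
  "hermitian A \<Longrightarrow> hermitian B \<Longrightarrow> ctrace (A o\<^sub>L B) = complex_of_real (hs_inner A B)"
  unfolding hs_inner_def by (metis ctrace_comp_hermitian_real Reals_cnj_iff of_real_Re)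

lemma hermitian_diff: "hermitian A \<Longrightarrow> hermitian B \<Longrightarrow> hermitian (A - B)"
  using subspace_diff[OF subspace_hermitian, of A B] by simp

lemma hs_inner_self_le_0_imp: "hermitian A \<Longrightarrow> hs_inner A A \<le> 0 \<Longrightarrow> A = 0"
  using ctrace_hermitian_square[of A] by (auto simp: hs_inner_def)

lemma hs_inner_diff_self:
  "hermitian A \<Longrightarrow> hermitian B \<Longrightarrow>
    hs_inner (A - B) (A - B) = hs_inner A A - 2 * hs_inner A B + hs_inner B B"
  by (simp add: hs_inner_diff_left hs_inner_diff_right hs_inner_commute[of B A])

lemma states_hermitian: "\<rho> \<in> states \<Longrightarrow> hermitian \<rho>"
  by (simp add: states_def)

text \<open>In an orthonormal basis tr(rho^2) is the sum of the squared moduli of all matrix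
  entries. Cauchy-Schwarz bounds each by a product of two diagonal entries, and these products sum
  to the square of the trace.\<close>

lemma purity_le_1:
  fixes \<rho> :: "'a::fd_chilbert \<Rightarrow>\<^sub>L 'a"
  assumes "\<rho> \<in> states"
  shows "hs_inner \<rho> \<rho> \<le> 1"
proof -
  have herm: "hermitian \<rho>" and pos: "\<And>x. 0 \<le> Re (cinner x (\<rho> x))" and tr: "ctrace \<rho> = 1"
    using assms by (auto simp: states_def)
  note lin = hermitian_linear[OF herm]
  obtain E :: "'a set" where E: "is_onb E" using ex_onb by blast
  have "ctrace (\<rho> o\<^sub>L \<rho>) = (\<Sum>e\<in>E. \<Sum>f\<in>E. cinner e (\<rho> f) * cinner f (\<rho> e))"
    using onb_trace_comp[of E E \<rho> \<rho> \<rho>] E hermitian_cinner[OF herm]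
    by (simp add: ctrace_onb[OF E linear_operators_comp[OF lin lin]])
  also have "\<dots> = complex_of_real (\<Sum>e\<in>E. \<Sum>f\<in>E. (cmod (cinner e (\<rho> f)))\<^sup>2)"
    unfolding of_real_sum complex_norm_square
    by (intro sum.cong refl) (metis cinner_commute hermitian_cinner[OF herm])
  finally have "hs_inner \<rho> \<rho> = (\<Sum>e\<in>E. \<Sum>f\<in>E. (cmod (cinner e (\<rho> f)))\<^sup>2)"
    by (simp add: hs_inner_def)
  also have "\<dots> \<le> (\<Sum>e\<in>E. \<Sum>f\<in>E. Re (cinner e (\<rho> e)) * Re (cinner f (\<rho> f)))"
    by (intro sum_mono cinner_positive_cauchy_schwarz herm pos)
  also have "\<dots> = (Re (ctrace \<rho>))\<^sup>2"
    by (simp add: ctrace_onb[OF E lin] power2_eq_square sum_product)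
  finally show ?thesis by (simp add: tr)
qed

lemma hs_inner_states_le_1:
  assumes "\<rho> \<in> states" "\<sigma> \<in> states"
  shows "hs_inner \<rho> \<sigma> \<le> 1"
proof (cases "\<rho> = \<sigma>")
  case False
  then have "0 < hs_inner (\<rho> - \<sigma>) (\<rho> - \<sigma>)"
    using hs_inner_self_le_0_imp[OF hermitian_diff[OF assms[THEN states_hermitian]]] by force
  then show ?thesis
    using hs_inner_diff_self[OF assms[THEN states_hermitian]] assms[THEN purity_le_1] by linarith
qed (use assms purity_le_1 in simp)

lemma hs_inner_states_eq_1_imp_eq:
  assumes "\<rho> \<in> states" "\<sigma> \<in> states" "hs_inner \<rho> \<sigma> = 1"
  shows "\<rho> = \<sigma>"
proof -
  note h = assms(1,2)[THEN states_hermitian]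
  have "hs_inner (\<rho> - \<sigma>) (\<rho> - \<sigma>) \<le> 0"
    using hs_inner_diff_self[OF h] assms(1,2)[THEN purity_le_1] assms(3) by linarith
  then have "\<rho> - \<sigma> = 0" by (rule hs_inner_self_le_0_imp[OF hermitian_diff[OF h]])
  then show ?thesis by simp
qed

text \<open>An average of two numbers that are at most 1 reaches 1 only if both do. This serves both
  extremality arguments, for states and for reduced states.\<close>

lemma hs_inner_convex_comb_eq_1:
  assumes "\<rho> \<in> states" "a \<in> states" "b \<in> states" "0 < u" "u < 1"
    and "(1 - u) * hs_inner a \<rho> + u * hs_inner b \<rho> = 1"
  shows "a = \<rho>" "b = \<rho>"
proof -
  have "hs_inner a \<rho> \<le> 1" "hs_inner b \<rho> \<le> 1"
    using assms hs_inner_states_le_1 by auto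
  \<comment> \<open>The weighted deficits from 1 are nonnegative and sum to zero, so each
    vanishes.\<close>
  then have "0 \<le> (1 - u) * (1 - hs_inner a \<rho>)" "0 \<le> u * (1 - hs_inner b \<rho>)"
    using assms by auto
  moreover have "(1 - u) * (1 - hs_inner a \<rho>) + u * (1 - hs_inner b \<rho>) = 0"
    using assms(6) by (simp add: algebra_simps)
  ultimately have "(1 - u) * (1 - hs_inner a \<rho>) = 0" "u * (1 - hs_inner b \<rho>) = 0"
    by linarith+
  then have "hs_inner a \<rho> = 1" "hs_inner b \<rho> = 1" using assms by auto
  then show "a = \<rho>" "b = \<rho>" using assms hs_inner_states_eq_1_imp_eq by auto
qed

text \<open>The witness is the orthogonal projection of \<open>\<rho>\<close> onto \<open>S\<close>.
  The two equations express that \<open>\<rho> - P\<close> is orthogonal to \<open>P\<close> and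
  that the squared length of \<open>P\<close> is the relative purity.\<close>

lemma relative_purity_projection:
  fixes S :: "('a::fd_chilbert \<Rightarrow>\<^sub>L 'a) set"
  assumes S: "subspace S" and herm: "\<And>A. A \<in> S \<Longrightarrow> hermitian A" and \<rho>: "hermitian \<rho>"
  shows "\<exists>P\<in>S. hs_inner P P = relative_purity S \<rho> \<and> hs_inner \<rho> P = relative_purity S \<rho>"
proof -
  obtain B where B: "is_trace_onb S B" using ex_trace_onb[OF S herm] by blast
  have fin: "finite B" and span: "span B = S"
    and on: "\<And>X Y. X \<in> B \<Longrightarrow> Y \<in> B \<Longrightarrow> ctrace (X o\<^sub>L Y) = (if X = Y then 1 else 0)"
    using B by (auto simp: is_trace_onb_def)
  have BS: "X \<in> S" if "X \<in> B" for X using that span span_base by blast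
  define P where "P = (\<Sum>X\<in>B. hs_inner \<rho> X *\<^sub>R X)"
  have PS: "P \<in> S" unfolding P_def span[symmetric] by (intro span_sum span_scale span_base)
  note P = herm[OF PS]
  have "hs_inner \<rho> P = (\<Sum>X\<in>B. (hs_inner \<rho> X)\<^sup>2)"
    by (simp add: P_def hs_inner_sum_right power2_eq_square)
  moreover have "relative_purity S \<rho> = (\<Sum>X\<in>B. (hs_inner \<rho> X)\<^sup>2)"
  proof -
    have "relative_purity S \<rho> = (\<Sum>X\<in>B. (cmod (ctrace (\<rho> o\<^sub>L X)))\<^sup>2)"
      by (rule relative_purity_eq[OF _ B \<rho>]) (rule herm)
    also have "\<dots> = (\<Sum>X\<in>B. (hs_inner \<rho> X)\<^sup>2)"
      by (rule sum.cong[OF refl]) (simp add: ctrace_comp_eq_hs_inner[OF \<rho> herm[OF BS]])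
    finally show ?thesis .
  qed
  moreover have "hs_inner P P = hs_inner \<rho> P"
  proof -
    \<comment> \<open>The residual \<open>\<rho> - P\<close> is orthogonal to every basis
      element.\<close>
    have PX: "hs_inner P X = hs_inner \<rho> X" if X: "X \<in> B" for X
    proof -
      have "hs_inner P X = hs_inner X P" by (rule hs_inner_commute[OF P herm[OF BS[OF X]]])
      also have "\<dots> = (\<Sum>Y\<in>B. hs_inner \<rho> Y * hs_inner X Y)"
        by (simp add: P_def hs_inner_sum_right)
      also have "\<dots> = (\<Sum>Y\<in>B. if X = Y then hs_inner \<rho> Y else 0)"
        by (rule sum.cong) (auto simp: hs_inner_def on X)
      finally show ?thesis using fin X by simp
    qed
    have "hs_inner P P = (\<Sum>X\<in>B. hs_inner \<rho> X * hs_inner P X)"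
      \<comment> \<open>Only the right-hand \<open>P\<close> is expanded; the left one stays intact
        so that \<open>PX\<close> applies to it.\<close>
      by (subst (2) P_def) (rule hs_inner_sum_right)
    also have "\<dots> = (\<Sum>X\<in>B. hs_inner \<rho> X * hs_inner \<rho> X)" by (simp add: PX)
    also have "\<dots> = hs_inner \<rho> P" by (simp add: P_def hs_inner_sum_right)
    finally show ?thesis .
  qed
  ultimately show ?thesis using PS by auto
qed

theorem proposition4p5:
  fixes W S :: "('a::fd_chilbert \<Rightarrow>\<^sub>L 'a) set" and \<omega> :: "'a \<Rightarrow>\<^sub>L 'a"
  assumes "operator_subspace W"
    and "\<And>A. A \<in> W \<Longrightarrow> cadjoint A \<in> W"
    and "id_blinfun \<in> W"
    and "S = {A \<in> W. hermitian A}"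
    and "\<omega> \<in> states"
    and "relative_purity S \<omega> = 1"
  shows "{\<sigma> \<in> states. reduced_state S \<sigma> = reduced_state S \<omega>} = {\<omega>}
    \<and> generalized_unentangled S \<omega>"
proof -
  note \<omega> = \<open>\<omega> \<in> states\<close>
  have S: "subspace S" and herm: "\<And>A. A \<in> S \<Longrightarrow> hermitian A"
    using subspace_hermitian_part[OF assms(1)] assms(4) by auto
  obtain P where P: "P \<in> S" "hs_inner P P = 1" "hs_inner \<omega> P = 1"
    using relative_purity_projection[OF S herm states_hermitian[OF \<omega>]] assms(6) by auto
  \<comment> \<open>The squared distance is tr(omega^2) - 2 + 1, which is at most 0 because the
    purity is at most 1.\<close>
  have "hs_inner (\<omega> - P) (\<omega> - P) \<le> 0"
    using hs_inner_diff_self[OF states_hermitian[OF \<omega>] herm[OF P(1)]] P purity_le_1[OF \<omega>]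
    by linarith
  then have "\<omega> - P = 0"
    by (rule hs_inner_self_le_0_imp[OF hermitian_diff[OF states_hermitian[OF \<omega>] herm[OF P(1)]]])
  then have mem: "\<omega> \<in> S" and pure: "hs_inner \<omega> \<omega> = 1"
    using P by simp_all
  \<comment> \<open>Membership in \<open>S\<close> is essential here: outside \<open>S\<close> a
    reduced state takes the default value 0.\<close>
  have eval: "Re (reduced_state S \<sigma> \<omega>) = hs_inner \<sigma> \<omega>" for \<sigma>
    using mem by (simp add: reduced_state_def hs_inner_def)
  have "{\<sigma> \<in> states. reduced_state S \<sigma> = reduced_state S \<omega>} = {\<omega>}"
  proof (intro subset_antisym subsetI)
    fix \<sigma> assume "\<sigma> \<in> {\<sigma> \<in> states. reduced_state S \<sigma> = reduced_state S \<omega>}"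
    then have \<sigma>: "\<sigma> \<in> states" and eq: "reduced_state S \<sigma> = reduced_state S \<omega>" by auto
    have "hs_inner \<sigma> \<omega> = 1" using eval[of \<sigma>] eval[of \<omega>] pure eq by simp
    then show "\<sigma> \<in> {\<omega>}" using hs_inner_states_eq_1_imp_eq[OF \<sigma> \<omega>] by simp
  qed (use \<omega> in simp)
  moreover have "\<omega> extreme_point_of states"
    unfolding extreme_point_of_def
  proof (intro conjI ballI notI)
    fix a b assume ab: "a \<in> states" "b \<in> states" "\<omega> \<in> open_segment a b"
    then obtain u where u: "a \<noteq> b" "0 < u" "u < 1" "\<omega> = (1 - u) *\<^sub>R a + u *\<^sub>R b"
      by (auto simp: in_segment)
    have "(1 - u) * hs_inner a \<omega> + u * hs_inner b \<omega> = 1"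
      \<comment> \<open>Pairing the decomposition with \<open>\<omega>\<close> turns it into an
        average of two overlaps.\<close>
      using arg_cong[OF u(4), of "\<lambda>A. hs_inner A \<omega>"] pure
      by (simp add: hs_inner_add_left hs_inner_scaleR_left)
    then show False using hs_inner_convex_comb_eq_1[OF \<omega> ab(1,2) u(2,3)] u(1) by simp
  qed (rule \<omega>)
  moreover have "reduced_state S \<omega> extreme_point_of reduced_states S"
    unfolding extreme_point_of_def
  proof (intro conjI ballI notI)
    fix f g
    assume "f \<in> reduced_states S" "g \<in> reduced_states S"
      and seg: "reduced_state S \<omega> \<in> open_segment f g"
    \<comment> \<open>The lifts \<open>a\<close> and \<open>b\<close> are arbitrary: their convex
      combination is not assumed to be \<open>\<omega>\<close>, only to have the same reduced
      state.\<close>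
    then obtain a b where ab: "a \<in> states" "b \<in> states" "f = reduced_state S a" "g = reduced_state S b"
      by (auto simp: reduced_states_def)
    from seg obtain u where u: "f \<noteq> g" "0 < u" "u < 1"
      "reduced_state S \<omega> = (1 - u) *\<^sub>R f + u *\<^sub>R g"
      by (auto simp: in_segment)
    have "hs_inner \<omega> \<omega> = (1 - u) * hs_inner a \<omega> + u * hs_inner b \<omega>"
      \<comment> \<open>Evaluating the functionals at the single operator \<open>\<omega>\<close>
        suffices.\<close>
      using arg_cong[OF u(4), of "\<lambda>h. Re (h \<omega>)"]
      by (simp add: ab(3,4) scaleR_fun_def plus_fun_def eval)
    \<comment> \<open>Both lifts equal \<open>\<omega>\<close>, so \<open>f = g\<close>, against the
      nondegeneracy of the segment.\<close>
    then show False
      using hs_inner_convex_comb_eq_1[OF \<omega> ab(1,2) u(2,3)] pure u(1) ab by simp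
  qed (use \<omega> in \<open>simp add: reduced_states_def\<close>)
  \<comment> \<open>\<open>\<omega>\<close> is itself one of the generating extreme points, so no
    proper mixture or limit is involved.\<close>
  ultimately show ?thesis
    unfolding generalized_unentangled_def
    by (intro conjI subsetD[OF closure_subset] hull_inc) auto
qed

end
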